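(* Let $f\in\mathcal{A}$ be such that $f(z)\neq 0$ for all $z\in\mathbb{D}\setminus\{0\}$ (so that $\frac{z}{f(z)}$, with value $1$ at $z=0$, is analytic in $\mathbb{D}$). If \[\left| f(z)\left[ \frac{z}{f(z)}\right]'' \right| \le \frac12 \quad\text{for all } z\in\mathbb{D},\] then $f\in\mathcal{S}^*$.
   Context: $\mathbb{D}=\{z\in\mathbb{C}:|z|<1\}$ is the open unit disk. $\mathcal{A}$ is the class of functions $f$ analytic in $\mathbb{D}$ with $f(0)=0$ and $f'(0)=1$. The class of starlike functions is $\mathcal{S}^*=\{f\in\mathcal{A}: \operatorname{Re}\frac{zf'(z)}{f(z)}>0 \text{ for all } z\in\mathbb{D}\}$, where $\frac{zf'(z)}{f(z)}$ is given its limiting value $1$ at $z=0$. Primes denote derivatives with respect to $z$. *)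

theory Defs
  imports "HOL-Complex_Analysis.Complex_Analysis"
begin

abbreviation unit_disk :: "complex set" ("\<D>") where
  "\<D> \<equiv> ball 0 1"

text \<open>Analytic functions on the disk are modelled as total functions of which only the
  restriction to \<open>\<D>\<close> matters; their values outside \<open>\<D>\<close> are arbitrary.\<close>

definition class_A :: "(complex \<Rightarrow> complex) set" ("\<A>") where
  "\<A> = {f. f analytic_on \<D> \<and> f 0 = 0 \<and> deriv f 0 = 1}"

text \<open>The quotients below are \<open>0 / 0\<close> at the origin, so their limiting value \<open>1\<close> is put in by hand.\<close>

definition log_deriv_quotient :: "(complex \<Rightarrow> complex) \<Rightarrow> complex \<Rightarrow> complex" where
  "log_deriv_quotient f z = (if z = 0 then 1 else z * deriv f z / f z)"

definition id_over :: "(complex \<Rightarrow> complex) \<Rightarrow> complex \<Rightarrow> complex" where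
  "id_over f z = (if z = 0 then 1 else z / f z)"

text \<open>A zero of \<open>f\<close> in \<open>\<D> - {0}\<close> excludes starlikeness, as it should: there division by zero makes
  the quotient \<open>0\<close>, whose real part is not positive.\<close>

definition starlike_functions :: "(complex \<Rightarrow> complex) set" ("\<S>\<^sup>*") where
  "\<S>\<^sup>* = {f \<in> \<A>. \<forall>z\<in>\<D>. Re (log_deriv_quotient f z) > 0}"

end

theory Submission
  imports Defs
begin

text \<open>Put \<open>g(z) = z / f(z)\<close>, which is analytic and zero-free on the disk, and
  \<open>p(z) = z f'(z) / f(z) = 1 - z g'(z) / g(z)\<close>. Starlikeness says that \<open>Re p > 0\<close>, and
  \<open>p(0) = 1\<close>. Differentiating \<open>p\<close> turns the second-order quantity of the hypothesis into a
  first-order expression of Riccati type (lemma \<open>Riccati_log_derivative\<close>):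
  \<open>p\<^sup>2 - p - z p' = z \<cdot> (f g'')\<close>. The right-hand side has modulus at most \<open>\<bar>z\<bar> / 2 < 1 / 2\<close>.

  Suppose that \<open>Re p\<close> is not positive everywhere, and let \<open>z\<close> be a point of smallest modulus
  with \<open>Re p(z) \<le> 0\<close>. There \<open>p(z) = i s\<close> is imaginary, and, as Miller and Mocanu observed, the
  values of \<open>z p'(z)\<close> are severely restricted: it is real and at most \<open>- (1 + s\<^sup>2) / 2\<close> (lemma
  \<open>Miller_Mocanu_first_contact\<close>, a consequence of the Schwarz lemma). But then
  \<open>p\<^sup>2 - p - z p'\<close> has modulus at least \<open>1 / 2\<close> (lemma \<open>norm_ge_half_at_contact\<close>),
  a contradiction.\<close>

section \<open>First contact with the imaginary axis\<close>

text \<open>The Cayley transform \<open>w \<mapsto> (1 - w) / (1 + w)\<close> maps the right half-plane onto the unit disk.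
  Taking \<open>t = 1\<close> below shows this; a general \<open>t\<close> describes the preimage of the disk of radius
  \<open>t\<close> without a division.\<close>

lemma norm_diff_power2_Cayley:
  "(cmod (1 - w))\<^sup>2 - t\<^sup>2 * (cmod (1 + w))\<^sup>2
     = (1 + (Re w)\<^sup>2 + (Im w)\<^sup>2) * (1 - t\<^sup>2) - 2 * Re w * (1 + t\<^sup>2)"
  unfolding cmod_power2 by (simp add: power2_eq_square algebra_simps)

text \<open>The Schwarz lemma, applied to the Cayley transform of \<open>P\<close> rescaled to the unit disk.\<close>

lemma Schwarz_positive_real_part:
  assumes hol: "P holomorphic_on ball 0 r" and "P 0 = 1"
    and pos: "\<And>z. z \<in> ball 0 r \<Longrightarrow> Re (P z) > 0" and z: "z \<in> ball 0 r"
  shows "r * cmod (1 - P z) \<le> cmod z * cmod (1 + P z)"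
proof -
  have r: "r > 0" using z by (auto intro: le_less_trans[OF norm_ge_zero])
  have ne: "1 + P w \<noteq> 0" if "w \<in> ball 0 r" for w
    using pos[OF that] by (auto simp: complex_eq_iff)
  define q where "q w = (1 - P (of_real r * w)) / (1 + P (of_real r * w))" for w
  have scale: "of_real r * w \<in> ball 0 r" if "cmod w < 1" for w
    using that r by (simp add: norm_mult)
  have "(\<lambda>w. P (of_real r * w)) holomorphic_on ball 0 1"
    by (rule holomorphic_on_compose_gen[OF _ hol, unfolded o_def])
      (use scale in \<open>auto intro!: holomorphic_intros\<close>)
  then have "q holomorphic_on ball 0 1"
    unfolding q_def using ne scale by (intro holomorphic_intros) auto
  moreover have "q 0 = 0" by (simp add: q_def \<open>P 0 = 1\<close>)
  moreover have "cmod (q w) < 1" if "cmod w < 1" for w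
  proof -
    have "(cmod (1 - P (of_real r * w)))\<^sup>2 < (cmod (1 + P (of_real r * w)))\<^sup>2"
      using norm_diff_power2_Cayley[of "P (of_real r * w)" 1] pos[OF scale[OF that]] by simp
    then have "cmod (1 - P (of_real r * w)) < cmod (1 + P (of_real r * w))"
      by (rule power2_less_imp_less) simp
    then show ?thesis
      using ne[OF scale[OF that]] by (simp add: q_def norm_divide)
  qed
  moreover have "cmod (z / of_real r) < 1" using z r by (simp add: norm_divide)
  ultimately have "cmod (q (z / of_real r)) \<le> cmod (z / of_real r)"
    using Schwarz_Lemma(1) by blast
  then show ?thesis
    using r ne[OF z] by (simp add: q_def norm_divide field_simps)
qed

lemma left_derivative_nonneg:
  fixes F :: "real \<Rightarrow> real"
  assumes "(F has_real_derivative D) (at 1)"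
    and "\<And>t. 0 < t \<Longrightarrow> t < 1 \<Longrightarrow> F t \<le> F 1"
  shows "D \<ge> 0"
proof (rule ccontr)
  assume "\<not> D \<ge> 0"
  then obtain d where d: "d > 0" "\<And>h. 0 < h \<Longrightarrow> h < d \<Longrightarrow> F 1 < F (1 - h)"
    using DERIV_neg_dec_left[OF assms(1)] by auto
  define h where "h = min (d / 2) (1 / 2)"
  have "0 < h" "h < d" "h < 1" using d(1) by (auto simp: h_def)
  then show False using d(2)[of h] assms(2)[of "1 - h"] by simp
qed

text \<open>At a contact point \<open>z\<close> of smallest modulus, \<open>Re P\<close> restricted to the circle through \<open>z\<close>
  has a minimum at \<open>z\<close>, so the tangential derivative \<open>- Im (z P'(z))\<close> of \<open>Re P\<close> vanishes.
  In the radial direction, the Schwarz lemma says that the Cayley transform of \<open>P\<close> has modulus at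
  most \<open>t\<close> at the point \<open>t z\<close> for \<open>0 < t < 1\<close>, with equality at \<open>t = 1\<close>; comparing the
  derivatives at \<open>t = 1\<close> bounds \<open>Re (z P'(z))\<close>.\<close>

lemma Miller_Mocanu_first_contact:
  assumes hol: "P holomorphic_on ball 0 R" and P0: "P 0 = 1"
    and "z1 \<in> ball 0 R" and "Re (P z1) \<le> 0"
  obtains z where "z \<in> ball 0 R" and "Re (P z) = 0" and "Im (z * deriv P z) = 0"
    and "Re (z * deriv P z) \<le> - (1 + (Im (P z))\<^sup>2) / 2"
proof -
  have cont: "continuous_on (cball 0 (cmod z1)) P"
    by (rule holomorphic_on_imp_continuous_on, rule holomorphic_on_subset[OF hol])
      (use assms(3) in auto)
  define K where "K = {z \<in> cball 0 (cmod z1). Re (P z) \<le> 0}"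
  have "K = cball 0 (cmod z1) \<inter> (\<lambda>z. Re (P z)) -` {..0}" by (auto simp: K_def)
  moreover have "closed (cball 0 (cmod z1) \<inter> (\<lambda>z. Re (P z)) -` {..0})"
    by (intro continuous_closed_preimage continuous_intros cont) auto
  ultimately have "closed K" by simp
  moreover have "bounded K" by (rule bounded_subset[OF bounded_cball[of 0 "cmod z1"]]) (auto simp: K_def)
  ultimately have "compact K" by (simp add: compact_eq_bounded_closed)
  moreover have "z1 \<in> K" using assms(4) by (simp add: K_def)
  ultimately obtain z where z: "z \<in> K" and zmin: "\<And>w. w \<in> K \<Longrightarrow> cmod z \<le> cmod w"
    using continuous_attains_inf[of K cmod] by (auto intro: continuous_intros)
  define r where "r = cmod z"
  have zR: "z \<in> ball 0 R" and rz1: "r \<le> cmod z1" using z assms(3) by (auto simp: K_def r_def)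
  have "z \<noteq> 0" using z P0 by (auto simp: K_def)
  then have r: "r > 0" by (simp add: r_def)
  have pos: "Re (P w) > 0" if "w \<in> ball 0 r" for w
    using zmin[of w] that rz1 by (force simp: K_def r_def)
  have nonneg: "Re (P w) \<ge> 0" if "w \<in> cball 0 r" for w
  proof (rule continuous_ge_on_closure[where S = "ball 0 r" and f = "\<lambda>w. Re (P w)"])
    show "continuous_on (closure (ball 0 r)) (\<lambda>w. Re (P w))"
      using r rz1 by (auto intro!: continuous_intros continuous_on_subset[OF cont])
    show "w \<in> closure (ball 0 r)" using that r by simp
  qed (use pos in \<open>auto intro: less_imp_le\<close>)
  have Re0: "Re (P z) = 0" using nonneg[of z] z by (simp add: r_def K_def)
  have der: "(P has_field_derivative deriv P z) (at z)"
    by (rule holomorphic_derivI[OF hol _ zR]) simp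
  have Im0: "Im (z * deriv P z) = 0"
  proof -
    have arc: "((\<lambda>\<theta>. cis \<theta> * z) has_vector_derivative \<i> * z) (at 0)"
      by (auto intro!: derivative_eq_intros simp: has_vector_derivative_def scaleR_conv_of_real)
    have "((\<lambda>\<theta>. P (cis \<theta> * z)) has_vector_derivative \<i> * z * deriv P z) (at 0)"
      by (rule field_vector_diff_chain_at[OF arc, unfolded o_def]) (use der in simp)
    then have "((\<lambda>\<theta>. Re (P (cis \<theta> * z))) has_real_derivative Re (\<i> * z * deriv P z)) (at 0)"
      by (rule has_field_derivative_Re)
    then have "Re (\<i> * z * deriv P z) = 0"
      by (rule DERIV_local_min[where d = 1]) (auto simp: Re0 norm_mult r_def[symmetric] intro!: nonneg)
    then show ?thesis by (simp add: algebra_simps)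
  qed
  have Rele: "Re (z * deriv P z) \<le> - (1 + (Im (P z))\<^sup>2) / 2"
  proof -
    define u where "u t = Re (P (of_real t * z))" for t
    define v where "v t = Im (P (of_real t * z))" for t
    \<comment> \<open>This is \<open>\<bar>1 - p\<bar>\<^sup>2 - t\<^sup>2 \<bar>1 + p\<bar>\<^sup>2\<close> for \<open>p = P (t z)\<close>, hence at most \<open>0\<close> by Schwarz.\<close>
    define F where "F t = (1 + (u t)\<^sup>2 + (v t)\<^sup>2) * (1 - t\<^sup>2) - 2 * u t * (1 + t\<^sup>2)" for t
    have ray: "((\<lambda>t. of_real t * z) has_vector_derivative z) (at 1)"
      by (auto intro!: derivative_eq_intros simp: has_vector_derivative_def scaleR_conv_of_real)
    have path: "((\<lambda>t. P (of_real t * z)) has_vector_derivative z * deriv P z) (at 1)"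
      by (rule field_vector_diff_chain_at[OF ray, unfolded o_def]) (use der in simp)
    have u': "(u has_real_derivative Re (z * deriv P z)) (at 1)"
      unfolding u_def by (rule has_field_derivative_Re[OF path])
    have v': "(v has_real_derivative Im (z * deriv P z)) (at 1)"
      unfolding v_def by (rule has_field_derivative_Im[OF path])
    have "u 1 = 0" "v 1 = Im (P z)" by (simp_all add: u_def v_def Re0)
    have "(F has_real_derivative - 2 * (1 + (Im (P z))\<^sup>2) - 4 * Re (z * deriv P z)) (at 1)"
      unfolding F_def
      by (auto intro!: derivative_eq_intros u' v' simp: \<open>u 1 = 0\<close> \<open>v 1 = Im (P z)\<close>)
    moreover have "F t \<le> F 1" if "0 < t" "t < 1" for t
    proof -
      have tz: "of_real t * z \<in> ball 0 r" using that r by (simp add: norm_mult r_def)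
      have "r * cmod (1 - P (of_real t * z)) \<le> cmod (of_real t * z) * cmod (1 + P (of_real t * z))"
      proof (rule Schwarz_positive_real_part)
        show "P holomorphic_on ball 0 r"
          by (rule holomorphic_on_subset[OF hol]) (use zR in \<open>auto simp: r_def\<close>)
      qed (use P0 pos tz in auto)
      then have "cmod (1 - P (of_real t * z)) \<le> t * cmod (1 + P (of_real t * z))"
        using r that by (simp add: norm_mult r_def[symmetric])
      then have "(cmod (1 - P (of_real t * z)))\<^sup>2 \<le> t\<^sup>2 * (cmod (1 + P (of_real t * z)))\<^sup>2"
        by (metis norm_ge_zero power_mono power_mult_distrib)
      then have "F t \<le> 0"
        using norm_diff_power2_Cayley[of "P (of_real t * z)" t] by (simp add: F_def u_def v_def)
      then show ?thesis by (simp add: F_def \<open>u 1 = 0\<close>)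
    qed
    ultimately have "- 2 * (1 + (Im (P z))\<^sup>2) - 4 * Re (z * deriv P z) \<ge> 0"
      by (rule left_derivative_nonneg)
    then show ?thesis by simp
  qed
  show thesis using that zR Re0 Im0 Rele by blast
qed

text \<open>With \<open>w = i s\<close> and \<open>d = - m\<close> the quantity is \<open>(m - s\<^sup>2) - i s\<close>, where
  \<open>m \<ge> (1 + s\<^sup>2) / 2\<close>. For \<open>\<bar>s\<bar> \<le> 1\<close> the real part is at least \<open>(1 - s\<^sup>2) / 2 \<ge> 0\<close>, and
  \<open>((1 - s\<^sup>2) / 2)\<^sup>2 + s\<^sup>2 = ((1 + s\<^sup>2) / 2)\<^sup>2 \<ge> 1 / 4\<close>; for \<open>\<bar>s\<bar> > 1\<close> the imaginary part alone
  suffices. The value \<open>1 / 2\<close> is attained at \<open>s = 0\<close>, \<open>m = 1 / 2\<close>.\<close>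

lemma norm_ge_half_at_contact:
  assumes "Re w = 0" and "Im d = 0" and "Re d \<le> - (1 + (Im w)\<^sup>2) / 2"
  shows "cmod (w\<^sup>2 - w - d) \<ge> 1 / 2"
proof -
  define s where "s = Im w"
  define m where "m = - Re d"
  have m: "m \<ge> (1 + s\<^sup>2) / 2" using assms(3) by (simp add: m_def s_def field_simps)
  have "(cmod (w\<^sup>2 - w - d))\<^sup>2 = (m - s\<^sup>2)\<^sup>2 + s\<^sup>2"
    using assms(1,2) unfolding cmod_power2
    by (simp add: m_def s_def power2_eq_square algebra_simps)
  moreover have "(m - s\<^sup>2)\<^sup>2 + s\<^sup>2 \<ge> 1 / 4"
  proof (cases "s\<^sup>2 \<le> 1")
    case True
    have "((1 - s\<^sup>2) / 2)\<^sup>2 \<le> (m - s\<^sup>2)\<^sup>2"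
      by (rule power_mono) (use True m in \<open>auto simp: field_simps\<close>)
    moreover have "((1 - s\<^sup>2) / 2)\<^sup>2 + s\<^sup>2 = 1 / 4 + s\<^sup>2 / 2 + (s\<^sup>2)\<^sup>2 / 4"
      by (simp add: power2_eq_square field_simps)
    ultimately show ?thesis
      using zero_le_power2[of s] zero_le_power2[of "s\<^sup>2"] by linarith
  next
    case False
    then show ?thesis using zero_le_power2[of "m - s\<^sup>2"] by linarith
  qed
  ultimately have "(1 / 2)\<^sup>2 \<le> (cmod (w\<^sup>2 - w - d))\<^sup>2"
    by (simp add: power2_eq_square)
  then show ?thesis by (rule power2_le_imp_le) simp
qed

section \<open>The logarithmic derivative in terms of the reciprocal quotient\<close>

text \<open>The origin is a removable singularity: \<open>f(z) / z\<close> tends to \<open>f'(0) = 1\<close>, so the value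
  \<open>1\<close> put in by hand makes the quotient continuous there.\<close>

lemma id_over_holomorphic:
  assumes "f \<in> \<A>" and nz: "\<And>z. z \<in> \<D> - {0} \<Longrightarrow> f z \<noteq> 0"
  shows "id_over f holomorphic_on \<D>"
proof (rule no_isolated_singularity[where K = "{0}"])
  have hol: "f holomorphic_on \<D>" and f0: "f 0 = 0" and d0: "deriv f 0 = 1"
    using assms(1) by (auto simp: class_A_def analytic_imp_holomorphic)
  have "(\<lambda>z. z / f z) holomorphic_on \<D> - {0}"
    using nz by (intro holomorphic_intros holomorphic_on_subset[OF hol]) auto
  then show hol': "id_over f holomorphic_on \<D> - {0}"
    by (rule holomorphic_transform) (simp add: id_over_def)
  have "(f has_field_derivative 1) (at 0)"
    using holomorphic_derivI[OF hol, of 0] d0 by simp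
  then have "((\<lambda>z. f z / z) \<longlongrightarrow> 1) (at 0)"
    by (simp add: has_field_derivative_iff f0)
  then have "((\<lambda>z. inverse (f z / z)) \<longlongrightarrow> inverse 1) (at 0)"
    by (rule tendsto_inverse) simp
  then have "(id_over f \<longlongrightarrow> 1) (at 0)"
    by (rule filterlim_mono_eventually) (auto simp: id_over_def eventually_at_filter)
  then have "isCont (id_over f) 0" by (simp add: isCont_def id_over_def)
  moreover have "isCont (id_over f) z" if "z \<in> \<D> - {0}" for z
    using holomorphic_on_imp_continuous_on[OF hol'] that
    by (simp add: continuous_on_eq_continuous_at open_Diff)
  ultimately show "continuous_on \<D> (id_over f)"
    by (intro continuous_at_imp_continuous_on) blast
qed auto

lemma log_deriv_quotient_eq:
  assumes "f \<in> \<A>" and nz: "\<And>z. z \<in> \<D> - {0} \<Longrightarrow> f z \<noteq> 0" and z: "z \<in> \<D>"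
  shows "log_deriv_quotient f z = 1 - z * deriv (id_over f) z / id_over f z"
proof (cases "z = 0")
  case False
  have hol: "f holomorphic_on \<D>"
    using assms(1) by (auto simp: class_A_def analytic_imp_holomorphic)
  have fz: "f z \<noteq> 0" using nz z False by simp
  have "(f has_field_derivative deriv f z) (at z)"
    by (rule holomorphic_derivI[OF hol _ z]) simp
  then have "((\<lambda>w. w / f w) has_field_derivative (f z - z * deriv f z) / (f z)\<^sup>2) (at z)"
    using fz by (auto intro!: derivative_eq_intros simp: power2_eq_square)
  then have "(id_over f has_field_derivative (f z - z * deriv f z) / (f z)\<^sup>2) (at z)"
    by (rule has_field_derivative_transform_within_open[where S = "- {0}"])
      (use False in \<open>auto simp: id_over_def\<close>)
  then have "deriv (id_over f) z = (f z - z * deriv f z) / (f z)\<^sup>2"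
    by (rule DERIV_imp_deriv)
  then show ?thesis
    using False fz by (simp add: log_deriv_quotient_def id_over_def power2_eq_square field_simps)
qed (simp add: log_deriv_quotient_def)

text \<open>Writing \<open>v = z g' / g\<close>, the quotient rule gives \<open>z v' = v + z\<^sup>2 g'' / g - v\<^sup>2\<close>. Substituting
  \<open>v = 1 - P\<close> isolates the term with \<open>g''\<close>.\<close>

lemma Riccati_log_derivative:
  assumes g: "g holomorphic_on S" and "open S" and z: "z \<in> S" and gz: "g z \<noteq> 0"
  defines "P \<equiv> \<lambda>w. 1 - w * deriv g w / g w"
  shows "(P z)\<^sup>2 - P z - z * deriv P z = z * (z / g z * deriv (deriv g) z)"
proof -
  have g1: "(g has_field_derivative deriv g z) (at z)"
    by (rule holomorphic_derivI[OF g \<open>open S\<close> z])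
  have g2: "(deriv g has_field_derivative deriv (deriv g) z) (at z)"
    by (rule holomorphic_derivI[OF holomorphic_deriv[OF g \<open>open S\<close>] \<open>open S\<close> z])
  have "(P has_field_derivative
      - ((deriv g z + z * deriv (deriv g) z) * g z - z * deriv g z * deriv g z) / (g z * g z)) (at z)"
    unfolding P_def using gz
    by (auto intro!: derivative_eq_intros g1 g2 simp: algebra_simps minus_divide_left)
  then have dP: "deriv P z
      = - ((deriv g z + z * deriv (deriv g) z) * g z - z * deriv g z * deriv g z) / (g z * g z)"
    by (rule DERIV_imp_deriv)
  have Pz: "P z = 1 - z * deriv g z / g z" by (simp add: P_def)
  show ?thesis
    unfolding dP Pz using gz by (simp add: power2_eq_square field_simps)
qed

section \<open>The starlikeness criterion\<close>

theorem theorem3: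
  fixes f :: "complex \<Rightarrow> complex"
  assumes "f \<in> \<A>"
    and "\<And>z. z \<in> \<D> - {0} \<Longrightarrow> f z \<noteq> 0"
    and "\<And>z. z \<in> \<D> \<Longrightarrow> cmod (f z * deriv (deriv (id_over f)) z) \<le> 1 / 2"
  shows "f \<in> \<S>\<^sup>*"
proof -
  define g where "g = id_over f"
  define P where "P = (\<lambda>w. 1 - w * deriv g w / g w)"
  have f0: "f 0 = 0" using assms(1) by (simp add: class_A_def)
  have g: "g holomorphic_on \<D>"
    unfolding g_def by (rule id_over_holomorphic[OF assms(1,2)])
  have gnz: "g z \<noteq> 0" if "z \<in> \<D>" for z
    using assms(2)[of z] that by (auto simp: g_def id_over_def)
  have f_eq: "f z = z / g z" for z
    by (simp add: g_def id_over_def f0)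
  have P_hol: "P holomorphic_on \<D>"
    unfolding P_def using gnz g by (intro holomorphic_intros) auto
  have "Re (P z) > 0" if z: "z \<in> \<D>" for z
  proof (rule ccontr)
    assume "\<not> Re (P z) > 0"
    then obtain w where w: "w \<in> \<D>" and contact: "Re (P w) = 0" "Im (w * deriv P w) = 0"
        "Re (w * deriv P w) \<le> - (1 + (Im (P w))\<^sup>2) / 2"
      using Miller_Mocanu_first_contact[OF P_hol _ z] by (auto simp: P_def not_less)
    have "1 / 2 \<le> cmod ((P w)\<^sup>2 - P w - w * deriv P w)"
      by (rule norm_ge_half_at_contact[OF contact])
    also have "\<dots> = cmod (w * (f w * deriv (deriv g) w))"
      using Riccati_log_derivative[OF g _ w gnz[OF w]] by (simp add: P_def f_eq)
    also have "\<dots> \<le> cmod w * (1 / 2)"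
      unfolding norm_mult[of w] g_def by (intro mult_left_mono assms(3) w norm_ge_zero)
    also have "\<dots> < 1 / 2" using w by simp
    finally show False by simp
  qed
  then show ?thesis
    using assms(1) log_deriv_quotient_eq[OF assms(1,2)]
    by (simp add: starlike_functions_def P_def g_def)
qed

end
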